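(* For every integer $N \ge 3$, $$\lambda_2^N := \max_{(u,(x,y)) \in O^N_1 \times O^N_2} \Phi_2^N(u,(x,y)) \;\le\; \frac{4}{3},$$ where $$\Phi_2^N(u,(x,y)) := \sum_{1 \le i,j \le N} u_i\, u_j\, \left| x_i x_j + y_i y_j \right|.$$
   Context: For integers $1 \le n \le N$, $O^N_n$ denotes the set of $n$-tuples of orthonormal vectors in $\mathbb{R}^N$ with its standard Euclidean inner product. Thus $O^N_1$ is the set of unit vectors $u = (u_1,\dots,u_N) \in \mathbb{R}^N$, and $O^N_2$ is the set of pairs $(x,y)$ of vectors in $\mathbb{R}^N$ with $\|x\| = \|y\| = 1$ and $\langle x, y\rangle = 0$ (Euclidean norm and inner product). *)

theory Defs
  imports "HOL-Analysis.Analysis"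
begin

definition O1 :: "(real ^ 'n) set" where
  "O1 = {u. norm u = 1}"

definition O2 :: "((real ^ 'n) \<times> (real ^ 'n)) set" where
  "O2 = {(x, y). norm x = 1 \<and> norm y = 1 \<and> x \<bullet> y = 0}"

definition Phi2 :: "(real ^ 'n) \<times> (real ^ 'n) \<times> (real ^ 'n) \<Rightarrow> real" where
  "Phi2 = (\<lambda>(u, x, y). \<Sum>i\<in>UNIV. \<Sum>j\<in>UNIV. u $ i * u $ j * \<bar>x $ i * x $ j + y $ i * y $ j\<bar>)"

text \<open>The dimension \<open>N\<close> is \<open>CARD('n)\<close>, passed as a type token. \<open>Greatest\<close> denotes a genuine
  maximum only if one is attained; \<open>lambda2_is_max\<close> below shows that it is for \<open>N \<ge> 2\<close>.\<close>

definition lambda2 :: "'n::finite itself \<Rightarrow> real" where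
  "lambda2 _ = (GREATEST r. r \<in> Phi2 ` ((O1 :: (real ^ 'n) set) \<times> O2))"

lemma O2_nonempty:
  assumes "CARD('n::finite) \<ge> 2"
  shows "(O2 :: ((real ^ 'n) \<times> (real ^ 'n)) set) \<noteq> {}"
proof -
  obtain i j :: 'n where "i \<noteq> j"
    using card_le_Suc0_iff_eq[of "UNIV :: 'n set"] assms by auto
  then have "(axis i 1, axis j 1) \<in> (O2 :: ((real ^ 'n) \<times> (real ^ 'n)) set)"
    by (simp add: O2_def inner_axis_axis)
  then show ?thesis by blast
qed

lemma compact_O1_O2:
  "compact ((O1 :: (real ^ 'n::finite) set) \<times> (O2 :: ((real ^ 'n) \<times> (real ^ 'n)) set))"
proof -
  have 1: "compact (O1 :: (real ^ 'n) set)"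
    using compact_sphere[of "0 :: real ^ 'n" 1] by (simp add: O1_def sphere_def)
  have eq: "O2 = (O1 \<times> O1) \<inter> {p :: (real ^ 'n) \<times> (real ^ 'n). fst p \<bullet> snd p = 0}"
    by (auto simp: O1_def O2_def)
  have "closed {p :: (real ^ 'n) \<times> (real ^ 'n). fst p \<bullet> snd p = 0}"
    by (intro closed_Collect_eq continuous_intros)
  then have "compact (O2 :: ((real ^ 'n) \<times> (real ^ 'n)) set)"
    unfolding eq by (intro compact_Int_closed compact_Times 1)
  then show ?thesis by (intro compact_Times 1)
qed

lemma lambda2_is_max:
  assumes "CARD('n::finite) \<ge> 2"
  shows "lambda2 TYPE('n) \<in> Phi2 ` ((O1 :: (real ^ 'n) set) \<times> O2)"
    and "\<And>p. p \<in> (O1 :: (real ^ 'n) set) \<times> O2 \<Longrightarrow> Phi2 p \<le> lambda2 TYPE('n)"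
proof -
  let ?S = "(O1 :: (real ^ 'n) set) \<times> (O2 :: ((real ^ 'n) \<times> (real ^ 'n)) set)"
  have "axis i 1 \<in> (O1 :: (real ^ 'n) set)" for i
    by (simp add: O1_def)
  then have "?S \<noteq> {}"
    using O2_nonempty[OF assms] by blast
  moreover have "continuous_on ?S Phi2"
    unfolding Phi2_def case_prod_unfold by (intro continuous_intros)
  ultimately obtain p where p: "p \<in> ?S" "\<And>q. q \<in> ?S \<Longrightarrow> Phi2 q \<le> Phi2 p"
    using continuous_attains_sup[OF compact_O1_O2, of Phi2] by blast
  then have eq: "lambda2 TYPE('n) = Phi2 p"
    unfolding lambda2_def by (intro Greatest_equality) auto
  show "lambda2 TYPE('n) \<in> Phi2 ` ?S"
    using eq p(1) by simp
  show "\<And>q. q \<in> ?S \<Longrightarrow> Phi2 q \<le> lambda2 TYPE('n)"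
    using eq p(2) by simp
qed

end

(* Write (x_i, y_i) = r_i (cos a_i, sin a_i) and q_i = |u_i| r_i. On [0,1] the polynomial
   2/9 + 11/9 t^2 - 4/9 t^4 dominates t, touching it at t = 1/2 and t = 1, the values of
   |cos| in the extremal configuration of three lines at angles 60 degrees. In terms of
   t = |cos b| it reads 2/3 + 7/18 cos 2b - 1/18 cos 4b, so that
   Phi <= 2/3 P^2 + 7/18 L^2, where P is the sum of the q_i and L^2 is the squared modulus
   of the sum of the q_i exp(2 i a_i); the term with cos 4b contributes a negative multiple
   of a square. Orthonormality of x and y says that the sum of the r_i^2 exp(2 i a_i)
   vanishes, and Cauchy-Schwarz then gives P^2 + L^2 <= 2. *)

theory Submission
  imports Defs
begin

lemma le_quartic:
  fixes t :: real
  assumes "0 \<le> t" "t \<le> 1"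
  shows "t \<le> 2/9 + 11/9 * t^2 - 4/9 * t^4"
proof -
  \<comment> \<open>Tangency at \<open>1/2\<close> gives the double root, contact at the endpoint
    \<open>1\<close> the simple one; the missing cubic term forces the fourth root to be
    \<open>-2\<close>.\<close>
  have "0 \<le> (1 - t) * (t + 2) * (2 * t - 1)^2"
    using assms by (intro mult_nonneg_nonneg) auto
  also have "\<dots> = 9 * (2/9 + 11/9 * t^2 - 4/9 * t^4 - t)"
    by algebra
  finally show ?thesis by simp
qed

lemma abs_cos_le_fourier:
  fixes b :: real
  shows "\<bar>cos b\<bar> \<le> 2/3 + 7/18 * cos (2 * b) - 1/18 * cos (4 * b)"
proof -
  have 2: "cos (2 * b) = 2 * (cos b)^2 - 1"
    by (rule cos_double_cos)
  have "cos (4 * b) = 2 * (cos (2 * b))^2 - 1"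
    using cos_double_cos[of "2 * b"] by simp
  then have 4: "cos (4 * b) = 8 * (cos b)^4 - 8 * (cos b)^2 + 1"
    unfolding 2 by algebra
  have "\<bar>cos b\<bar> \<le> 2/9 + 11/9 * \<bar>cos b\<bar>^2 - 4/9 * \<bar>cos b\<bar>^4"
    by (intro le_quartic) auto
  then show ?thesis
    unfolding 2 4 by (simp add: algebra_simps)
qed

text \<open>Both sides are the squared modulus of the sum of \<open>q i\<close> times exp(i k
  \<open>a i\<close>), so each cosine kernel is positive semidefinite.\<close>

lemma sum_cos_diff:
  fixes q a :: "'i \<Rightarrow> real" and k :: real
  shows "(\<Sum>i\<in>I. \<Sum>j\<in>I. q i * q j * cos (k * (a i - a j)))
    = (\<Sum>i\<in>I. q i * cos (k * a i))^2 + (\<Sum>i\<in>I. q i * sin (k * a i))^2"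
  by (simp add: power2_eq_square sum_product sum.distrib[symmetric] right_diff_distrib
      cos_diff algebra_simps)

lemma sum_abs_cos_diff_le:
  fixes q a :: "'i \<Rightarrow> real"
  assumes "\<And>i. i \<in> I \<Longrightarrow> 0 \<le> q i"
  shows "(\<Sum>i\<in>I. \<Sum>j\<in>I. q i * q j * \<bar>cos (a i - a j)\<bar>)
    \<le> 2/3 * (\<Sum>i\<in>I. q i)^2
      + 7/18 * ((\<Sum>i\<in>I. q i * cos (2 * a i))^2 + (\<Sum>i\<in>I. q i * sin (2 * a i))^2)"
proof -
  have "(\<Sum>i\<in>I. \<Sum>j\<in>I. q i * q j * \<bar>cos (a i - a j)\<bar>)
    \<le> (\<Sum>i\<in>I. \<Sum>j\<in>I. q i * q j *
        (2/3 + 7/18 * cos (2 * (a i - a j)) - 1/18 * cos (4 * (a i - a j))))"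
    using assms by (intro sum_mono mult_left_mono abs_cos_le_fourier) auto
  also have "\<dots> = 2/3 * (\<Sum>i\<in>I. \<Sum>j\<in>I. q i * q j)
      + 7/18 * (\<Sum>i\<in>I. \<Sum>j\<in>I. q i * q j * cos (2 * (a i - a j)))
      - 1/18 * (\<Sum>i\<in>I. \<Sum>j\<in>I. q i * q j * cos (4 * (a i - a j)))"
    unfolding sum_distrib_left sum.distrib[symmetric] sum_subtractf[symmetric]
    by (intro sum.cong refl) (simp only: distrib_left right_diff_distrib mult.left_commute mult.commute)
  also have "\<dots> \<le> 2/3 * (\<Sum>i\<in>I. q i)^2
      + 7/18 * ((\<Sum>i\<in>I. q i * cos (2 * a i))^2 + (\<Sum>i\<in>I. q i * sin (2 * a i))^2)"
    \<comment> \<open>The frequency 4 part is \<open>-1/18\<close> times a sum of two squares and is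
      dropped.\<close>
    using sum_power2_ge_zero[of "\<Sum>i\<in>I. q i * cos (4 * a i)" "\<Sum>i\<in>I. q i * sin (4 * a i)"]
    unfolding sum_cos_diff sum_product[symmetric] power2_eq_square[of "\<Sum>i\<in>I. q i", symmetric]
    by argo
  finally show ?thesis .
qed

text \<open>The left side T is linear in \<open>v\<close>: it pairs \<open>v\<close> with the vector
  of entries \<open>r i * (P + f i)\<close>. By \<open>c\<close> and \<open>s\<close> the squared
  norm of that vector is at most 2 T, so Cauchy-Schwarz yields T^2 \<le> 2 T.\<close>

lemma sum_sq_moments_le_2:
  fixes v r a :: "'i \<Rightarrow> real"
  assumes v: "(\<Sum>i\<in>I. (v i)^2) = 1"
    and r: "(\<Sum>i\<in>I. (r i)^2) = 2"
    and c: "(\<Sum>i\<in>I. (r i)^2 * cos (2 * a i)) = 0"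
    and s: "(\<Sum>i\<in>I. (r i)^2 * sin (2 * a i)) = 0"
  shows "(\<Sum>i\<in>I. v i * r i)^2
    + ((\<Sum>i\<in>I. v i * r i * cos (2 * a i))^2 + (\<Sum>i\<in>I. v i * r i * sin (2 * a i))^2) \<le> 2"
proof -
  define P where "P = (\<Sum>i\<in>I. v i * r i)"
  define C where "C = (\<Sum>i\<in>I. v i * r i * cos (2 * a i))"
  define S where "S = (\<Sum>i\<in>I. v i * r i * sin (2 * a i))"
  \<comment> \<open>\<open>f i\<close> is the component of the vector (C, S) along the unit vector
    at angle \<open>2 * a i\<close>.\<close>
  define f where "f i = C * cos (2 * a i) + S * sin (2 * a i)" for i
  let ?T = "P^2 + (C^2 + S^2)"
  have T: "(\<Sum>i\<in>I. v i * (r i * (P + f i))) = ?T"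
  proof -
    have "(\<Sum>i\<in>I. v i * (r i * (P + f i)))
      = P * (\<Sum>i\<in>I. v i * r i) + (C * (\<Sum>i\<in>I. v i * r i * cos (2 * a i))
        + S * (\<Sum>i\<in>I. v i * r i * sin (2 * a i)))"
      unfolding f_def by (simp add: sum_distrib_left sum.distrib algebra_simps)
    then show ?thesis
      unfolding P_def[symmetric] C_def[symmetric] S_def[symmetric] by (simp add: power2_eq_square)
  qed
  have f: "(f i)^2 \<le> C^2 + S^2" for i
  proof -
    \<comment> \<open>The remainder is the squared component of (C, S) orthogonal to that unit
      vector.\<close>
    have "C^2 + S^2 - (f i)^2
        = (C * sin (2 * a i) - S * cos (2 * a i))^2"
      unfolding f_def using sin_cos_squared_add[of "2 * a i"] by algebra
    then show ?thesis
      using zero_le_power2[of "C * sin (2 * a i) - S * cos (2 * a i)"] by linarith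
  qed
  have rf: "(\<Sum>i\<in>I. (r i)^2 * f i) = 0"
  proof -
    have "(\<Sum>i\<in>I. (r i)^2 * f i)
      = C * (\<Sum>i\<in>I. (r i)^2 * cos (2 * a i)) + S * (\<Sum>i\<in>I. (r i)^2 * sin (2 * a i))"
      unfolding f_def by (simp add: sum_distrib_left sum.distrib algebra_simps)
    then show ?thesis using c s by simp
  qed
  have "(\<Sum>i\<in>I. (r i * (P + f i))^2)
    = P^2 * (\<Sum>i\<in>I. (r i)^2) + 2 * P * (\<Sum>i\<in>I. (r i)^2 * f i) + (\<Sum>i\<in>I. (r i)^2 * (f i)^2)"
    by (simp add: sum_distrib_left sum.distrib power2_eq_square algebra_simps)
  also have "\<dots> = 2 * P^2 + (\<Sum>i\<in>I. (r i)^2 * (f i)^2)"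
    using r rf by simp
  also have "\<dots> \<le> 2 * P^2 + (\<Sum>i\<in>I. (r i)^2 * (C^2 + S^2))"
    by (intro add_left_mono sum_mono mult_left_mono f) auto
  also have "\<dots> = 2 * ?T"
    using r by (simp add: sum_distrib_right[symmetric])
  finally have "(\<Sum>i\<in>I. (r i * (P + f i))^2) \<le> 2 * ?T" .
  moreover have "?T^2 \<le> (\<Sum>i\<in>I. (v i)^2) * (\<Sum>i\<in>I. (r i * (P + f i))^2)"
    unfolding T[symmetric] by (rule Cauchy_Schwarz_ineq_sum)
  ultimately have "?T * ?T \<le> 2 * ?T"
    using v by (simp add: power2_eq_square)
  moreover have "0 \<le> ?T" by simp
  ultimately have "?T \<le> 2"
    by (metis mult_right_le_imp_le order_le_less zero_le_numeral)
  then show ?thesis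
    unfolding P_def C_def S_def .
qed

lemma Phi2_le:
  fixes u x y :: "real ^ 'n::finite"
  assumes u: "u \<in> O1" and xy: "(x, y) \<in> O2"
  shows "Phi2 (u, x, y) \<le> 4 / 3"
proof -
  define r where "r i = cmod (Complex (x $ i) (y $ i))" for i
  \<comment> \<open>Where both coordinates vanish, \<open>r i = 0\<close> and the polar form holds
    whatever the angle.\<close>
  define a where "a i = Arg (Complex (x $ i) (y $ i))" for i
  have "Complex (x $ i) (y $ i) = rcis (r i) (a i)" for i
    unfolding r_def a_def by (simp add: rcis_cmod_Arg)
  then have x: "x $ i = r i * cos (a i)" and y: "y $ i = r i * sin (a i)" for i
    by (simp_all add: complex_eq_iff)
  \<comment> \<open>Absolute values make the weights nonnegative, as the termwise kernel bound
    requires; they preserve the norm of \<open>u\<close> and can only increase the sum.\<close>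
  define q where "q i = \<bar>u $ i\<bar> * r i" for i
  have q: "0 \<le> q i" for i
    unfolding q_def r_def by simp
  have xx: "(\<Sum>i\<in>UNIV. (x $ i)^2) = 1" and yy: "(\<Sum>i\<in>UNIV. (y $ i)^2) = 1"
    and xy0: "(\<Sum>i\<in>UNIV. x $ i * y $ i) = 0"
    using xy by (auto simp: O2_def norm_vec_def L2_set_def inner_vec_def)
  have uu: "(\<Sum>i\<in>UNIV. \<bar>u $ i\<bar>^2) = 1"
    using u by (simp add: O1_def norm_vec_def L2_set_def)
  have rr: "(\<Sum>i\<in>UNIV. (r i)^2) = 2"
  proof -
    have "(\<Sum>i\<in>UNIV. (r i)^2) = (\<Sum>i\<in>UNIV. (x $ i)^2 + (y $ i)^2)"
      by (simp add: r_def cmod_power2)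
    then show ?thesis using xx yy by (simp add: sum.distrib)
  qed
  have rc: "(\<Sum>i\<in>UNIV. (r i)^2 * cos (2 * a i)) = 0"
  proof -
    have "(\<Sum>i\<in>UNIV. (r i)^2 * cos (2 * a i)) = (\<Sum>i\<in>UNIV. (x $ i)^2 - (y $ i)^2)"
      by (simp add: x y cos_double power_mult_distrib right_diff_distrib)
    then show ?thesis using xx yy by (simp add: sum_subtractf)
  qed
  have rs: "(\<Sum>i\<in>UNIV. (r i)^2 * sin (2 * a i)) = 0"
  proof -
    have "(\<Sum>i\<in>UNIV. (r i)^2 * sin (2 * a i)) = (\<Sum>i\<in>UNIV. 2 * (x $ i * y $ i))"
      unfolding x y sin_double by (simp add: power2_eq_square ac_simps)
    then show ?thesis using xy0 by (simp flip: sum_distrib_left)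
  qed
  let ?P2 = "(\<Sum>i\<in>UNIV. q i)^2"
  let ?L2 = "(\<Sum>i\<in>UNIV. q i * cos (2 * a i))^2 + (\<Sum>i\<in>UNIV. q i * sin (2 * a i))^2"
  have "u $ i * u $ j * \<bar>x $ i * x $ j + y $ i * y $ j\<bar> \<le> q i * q j * \<bar>cos (a i - a j)\<bar>" for i j
  proof -
    have "x $ i * x $ j + y $ i * y $ j = r i * r j * cos (a i - a j)"
      by (simp add: x y cos_diff algebra_simps)
    moreover have "\<bar>r i\<bar> = r i" for i
      by (simp add: r_def)
    ultimately have "q i * q j * \<bar>cos (a i - a j)\<bar>
        = \<bar>u $ i * u $ j\<bar> * \<bar>x $ i * x $ j + y $ i * y $ j\<bar>"
      by (simp add: q_def abs_mult)
    then show ?thesis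
      by (simp add: mult_right_mono)
  qed
  then have "Phi2 (u, x, y) \<le> (\<Sum>i\<in>UNIV. \<Sum>j\<in>UNIV. q i * q j * \<bar>cos (a i - a j)\<bar>)"
    unfolding Phi2_def case_prod_conv by (intro sum_mono)
  also have "\<dots> \<le> 2/3 * ?P2 + 7/18 * ?L2"
    using q by (intro sum_abs_cos_diff_le)
  \<comment> \<open>Raising \<open>7/18\<close> to \<open>2/3\<close> loses nothing exactly when
    \<open>?L2\<close> is zero.\<close>
  also have "\<dots> \<le> 2/3 * (?P2 + ?L2)"
    using sum_power2_ge_zero[of "\<Sum>i\<in>UNIV. q i * cos (2 * a i)" "\<Sum>i\<in>UNIV. q i * sin (2 * a i)"]
    by argo
  also have "\<dots> \<le> 4 / 3"
    using sum_sq_moments_le_2[OF uu rr rc rs] unfolding q_def by argo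
  finally show ?thesis .
qed

theorem mainTheorem2:
  assumes "CARD('n::finite) \<ge> 3"
  shows "lambda2 TYPE('n) \<le> 4 / 3"
proof -
  have "CARD('n) \<ge> 2"
    using assms by simp
  \<comment> \<open>The maximum is attained, so it is itself a value of \<open>Phi2\<close> and the
    pointwise bound applies.\<close>
  from lambda2_is_max(1)[OF this] show ?thesis
    using Phi2_le by auto
qed

end
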